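(* Let $B^3\subset\mathbb{R}^3$ be the closed unit ball and let $M\subset B^3$ be an embedded compact free boundary minimal surface. Then for every straight line $\Gamma$ passing through the origin, either $M$ meets $\Gamma$ (i.e. $M\cap\Gamma\neq\emptyset$) or $M$ links $\Gamma$.
   Context: A free boundary minimal surface in $B^3$ is a compact surface properly immersed in $B^3$ whose mean curvature vector vanishes and which meets $S^2=\partial B^3$ orthogonally along its boundary. A surface $\Sigma\subset B^3$ links a curve $\Gamma$ if $\Sigma$ does not meet $\Gamma$ and $\Sigma$ is homotopically non-trivial (relative to $\partial B^3$) in $B^3\setminus\Gamma$; that is, the inclusion of pairs $(\Sigma,\partial\Sigma)\to(B^3\setminus\Gamma,\ \partial B^3\setminus\Gamma)$ is not homotopic, through maps of pairs, to a constant map. *)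

theory Defs
  imports "HOL-Analysis.Analysis"
begin

text \<open>\<open>C\<^sup>k\<close> and \<open>C\<^sup>\<infinity>\<close> maps. Only used for open \<open>S\<close>.\<close>

primrec Ck_on :: "nat \<Rightarrow> ('a::real_normed_vector \<Rightarrow> 'b::real_normed_vector) \<Rightarrow> 'a set \<Rightarrow> bool" where
  "Ck_on 0 f S \<longleftrightarrow> continuous_on S f"
| "Ck_on (Suc k) f S \<longleftrightarrow>
     (\<forall>x\<in>S. f differentiable (at x)) \<and>
     (\<forall>v. Ck_on k (\<lambda>x. frechet_derivative f (at x) v) S)"

definition smooth_on :: "('a::real_normed_vector \<Rightarrow> 'b::real_normed_vector) \<Rightarrow> 'a set \<Rightarrow> bool" where
  "smooth_on f S \<longleftrightarrow> (\<forall>k. Ck_on k f S)"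

definition half_plane :: "(real^2) set" where
  "half_plane = {w. 0 \<le> w $ 1}"

text \<open>
  A local parametrization of the set \<open>M\<close> has domain \<open>W \<inter> half_plane\<close>, an arbitrary relatively open
  subset of the half plane; as usual, smoothness up to the boundary means that the map is given
  together with a smooth extension to the open set \<open>W\<close>. Interior parametrizations are those with
  \<open>W\<close> disjoint from the line \<open>w $ 1 = 0\<close>. Since the image is required to be open in \<open>M\<close> and the
  inverse to be continuous, \<open>M\<close> is embedded.
\<close>

definition local_param :: "(real^3) set \<Rightarrow> (real^2 \<Rightarrow> real^3) \<Rightarrow> (real^2) set \<Rightarrow> bool" where
  "local_param M X W \<longleftrightarrow>
     open W \<and> smooth_on X W \<and>
     (\<forall>w \<in> W \<inter> half_plane. inj (frechet_derivative X (at w))) \<and>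
     openin (top_of_set M) (X ` (W \<inter> half_plane)) \<and>
     (\<exists>Y. homeomorphism (W \<inter> half_plane) (X ` (W \<inter> half_plane)) X Y)"

definition embedded_surface :: "(real^3) set \<Rightarrow> bool" where
  "embedded_surface M \<longleftrightarrow>
     M \<noteq> {} \<and> (\<forall>p\<in>M. \<exists>X W. local_param M X W \<and> p \<in> X ` (W \<inter> half_plane))"

definition surface_boundary :: "(real^3) set \<Rightarrow> (real^3) set" where
  "surface_boundary M = {p. \<exists>X W w. local_param M X W \<and> w \<in> W \<and> w $ 1 = 0 \<and> p = X w}"

definition partial_deriv :: "2 \<Rightarrow> (real^2 \<Rightarrow> real^3) \<Rightarrow> real^2 \<Rightarrow> real^3" where
  "partial_deriv i X w = frechet_derivative X (at w) (axis i 1)"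

definition unit_normal :: "(real^2 \<Rightarrow> real^3) \<Rightarrow> real^2 \<Rightarrow> real^3" where
  "unit_normal X w = sgn (cross3 (partial_deriv 1 X w) (partial_deriv 2 X w))"

definition first_form :: "(real^2 \<Rightarrow> real^3) \<Rightarrow> 2 \<Rightarrow> 2 \<Rightarrow> real^2 \<Rightarrow> real" where
  "first_form X i j w = partial_deriv i X w \<bullet> partial_deriv j X w"

definition second_form :: "(real^2 \<Rightarrow> real^3) \<Rightarrow> 2 \<Rightarrow> 2 \<Rightarrow> real^2 \<Rightarrow> real" where
  "second_form X i j w = partial_deriv i (partial_deriv j X) w \<bullet> unit_normal X w"

text \<open>
  The classical formula \<open>H = (e G - 2 f F + g E) / (2 (E G - F\<^sup>2))\<close>, that is, half the trace of the
  second fundamental form with respect to the first. The vector \<open>H N\<close> does not depend on the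
  parametrization.
\<close>

definition mean_curvature_vector :: "(real^2 \<Rightarrow> real^3) \<Rightarrow> real^2 \<Rightarrow> real^3" where
  "mean_curvature_vector X w =
     ((second_form X 1 1 w * first_form X 2 2 w
       - 2 * second_form X 1 2 w * first_form X 1 2 w
       + second_form X 2 2 w * first_form X 1 1 w)
      / (2 * (first_form X 1 1 w * first_form X 2 2 w - (first_form X 1 2 w)\<^sup>2)))
     *\<^sub>R unit_normal X w"

definition minimal_surface :: "(real^3) set \<Rightarrow> bool" where
  "minimal_surface M \<longleftrightarrow> embedded_surface M \<and>
     (\<forall>X W. local_param M X W \<longrightarrow> (\<forall>w \<in> W \<inter> half_plane. mean_curvature_vector X w = 0))"

text \<open>
  Two surfaces meet orthogonally at a common point iff their normals there are orthogonal; the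
  unit normal of the unit sphere at \<open>p\<close> is \<open>p\<close> itself.
\<close>

definition meets_sphere_orthogonally :: "(real^3) set \<Rightarrow> bool" where
  "meets_sphere_orthogonally M \<longleftrightarrow>
     (\<forall>X W w. local_param M X W \<and> w \<in> W \<and> w $ 1 = 0 \<longrightarrow> orthogonal (unit_normal X w) (X w))"

text \<open>The condition \<open>surface_boundary M = M \<inter> sphere 0 1\<close> is properness in the unit ball.\<close>

definition embedded_compact_free_boundary_minimal_surface :: "(real^3) set \<Rightarrow> bool" where
  "embedded_compact_free_boundary_minimal_surface M \<longleftrightarrow>
     compact M \<and> M \<subseteq> cball 0 1 \<and> minimal_surface M \<and>
     surface_boundary M = M \<inter> sphere 0 1 \<and>
     meets_sphere_orthogonally M"

text \<open>
  The predicate argument of \<open>homotopic_with_canon\<close> is imposed on every stage of the homotopy, so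
  this is homotopy through maps of pairs.
\<close>

definition links :: "(real^3) set \<Rightarrow> (real^3) set \<Rightarrow> bool" where
  "links M \<Gamma> \<longleftrightarrow> M \<inter> \<Gamma> = {} \<and>
     \<not> (\<exists>c. homotopic_with_canon (\<lambda>f. f ` surface_boundary M \<subseteq> sphere 0 1 - \<Gamma>)
               M (cball 0 1 - \<Gamma>) id (\<lambda>_. c))"

definition line_through_origin :: "(real^3) set \<Rightarrow> bool" where
  "line_through_origin \<Gamma> \<longleftrightarrow> affine \<Gamma> \<and> aff_dim \<Gamma> = 1 \<and> 0 \<in> \<Gamma>"

end

(*
  If M neither meets nor links the line, the angle about the line lifts to a continuous function on
  M. Where it attains its maximum, M touches a half-plane H bounded by the line and stays on one side
  of it; H is minimal and meets the sphere orthogonally as well. Instead of passing through the strong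
  maximum principle and Hopf's lemma, the maximum point q is chosen nearest to the line among all
  maximum points, as measured by x . m, where m is orthogonal to the line and positive on H. With n
  normal to H, e along the line, s0 = q . m and t0 = q . e, perturb the function x . n on M by
    eps * ((s0 - x . m) + A * (x . m - s0)^2 - (x . e - t0)^2).
  Coordinate functions are harmonic on M and the gradient of x . m does not vanish at q, so for A
  large the perturbed function is strictly subharmonic near q, and on the boundary its outward
  derivative (which is in direction x) is negative. By the choice of q, for eps small it has a maximum
  off the relative boundary of a small neighbourhood of q in M: a contradiction.
*)
theory Submission
  imports Defs
begin

section \<open>Second derivatives of real functions\<close>

text \<open>The mean value theorem, applied once in direction \<open>v\<close>, turns the second
  difference into a difference of two values of \<open>f' _ v\<close>; differentiability of that
  function at the single point \<open>w\<close> then gives the limit. The quotient is symmetric in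
  \<open>u\<close> and \<open>v\<close>, which is what the next lemma exploits.\<close>

lemma second_difference_tendsto:
  fixes f :: "'a::real_normed_vector \<Rightarrow> real"
  assumes "open S" "w \<in> S" and f: "\<And>x. x \<in> S \<Longrightarrow> (f has_derivative f' x) (at x)"
    and g: "((\<lambda>x. f' x v) has_derivative g) (at w)"
  shows "((\<lambda>t. (f (w + t *\<^sub>R u + t *\<^sub>R v) - f (w + t *\<^sub>R u) - f (w + t *\<^sub>R v) + f w) / t\<^sup>2)
           \<longlongrightarrow> g u) (at_right 0)"
proof (rule tendstoI)
  fix \<epsilon> :: real assume "\<epsilon> > 0"
  define C where "C = norm u + 2 * norm v + 1"
  have C: "C > 0" unfolding C_def by (smt (verit) norm_ge_zero)
  have lin: "linear g" using g by (rule has_derivative_linear)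
  obtain r where r: "r > 0" "ball w r \<subseteq> S" using assms(1,2) open_contains_ball by blast
  obtain d where d: "d > 0"
    "\<And>y. norm (y - w) < d \<Longrightarrow> norm (f' y v - f' w v - g (y - w)) \<le> (\<epsilon> / (2 * C)) * norm (y - w)"
    using g[unfolded has_derivative_at_alt] \<open>\<epsilon> > 0\<close> C by (metis divide_pos_pos mult_pos_pos zero_less_numeral)
  define \<delta> where "\<delta> = min r d / C"
  have "\<delta> > 0" using r d C by (simp add: \<delta>_def)
  have main: "dist ((f (w + t *\<^sub>R u + t *\<^sub>R v) - f (w + t *\<^sub>R u) - f (w + t *\<^sub>R v) + f w) / t\<^sup>2) (g u) < \<epsilon>"
    if t: "0 < t" "t < \<delta>" for t
  proof -
    have tC: "t * C < r" "t * C < d" using t C by (auto simp: \<delta>_def field_simps)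
    have n1: "norm (t *\<^sub>R u + (s * t) *\<^sub>R v) \<le> t * (norm u + norm v)" if "0 \<le> s" "s \<le> 1" for s
    proof -
      have "norm (t *\<^sub>R u + (s * t) *\<^sub>R v) \<le> t * norm u + s * t * norm v"
        using norm_triangle_ineq[of "t *\<^sub>R u" "(s*t) *\<^sub>R v"] t that by simp
      also have "\<dots> \<le> t * norm u + 1 * t * norm v"
        using t that by (intro add_mono mult_right_mono) auto
      finally show ?thesis by (simp add: algebra_simps)
    qed
    have n2: "norm ((s * t) *\<^sub>R v) \<le> t * norm v" if "0 \<le> s" "s \<le> 1" for s
    proof -
      have "s * t * norm v \<le> 1 * t * norm v"
        using t that by (intro mult_right_mono) auto
      then show ?thesis using t that by simp
    qed
    have le: "t * (norm u + norm v) \<le> t * C" "t * norm v \<le> t * C"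
      using t by (auto simp: C_def intro!: mult_left_mono)
    have inS: "w + t *\<^sub>R u + (s * t) *\<^sub>R v \<in> S" "w + (s * t) *\<^sub>R v \<in> S" if "0 \<le> s" "s \<le> 1" for s
    proof -
      have "norm (t *\<^sub>R u + (s * t) *\<^sub>R v) < r" "norm ((s * t) *\<^sub>R v) < r"
        using n1[OF that] n2[OF that] le tC by linarith+
      then have "w + (t *\<^sub>R u + (s * t) *\<^sub>R v) \<in> ball w r" "w + (s * t) *\<^sub>R v \<in> ball w r"
        by (simp_all only: mem_ball dist_norm diff_add_cancel norm_minus_cancel
            add_diff_cancel_left' minus_diff_eq norm_minus_commute[of w])
      then show "w + t *\<^sub>R u + (s * t) *\<^sub>R v \<in> S" "w + (s * t) *\<^sub>R v \<in> S"
        using r(2) by (auto simp: add.assoc)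
    qed
    \<comment> \<open>The second difference is \<open>h 1 - h 0\<close>.\<close>
    define h where "h s = f (w + t *\<^sub>R u + (s * t) *\<^sub>R v) - f (w + (s * t) *\<^sub>R v)" for s
    have hd: "(h has_derivative (\<lambda>x. f' (w + t *\<^sub>R u + (s * t) *\<^sub>R v) ((x * t) *\<^sub>R v) 
        - f' (w + (s * t) *\<^sub>R v) ((x * t) *\<^sub>R v))) (at s)" if "0 \<le> s" "s \<le> 1" for s
      unfolding h_def
      by (rule has_derivative_diff;
          rule has_derivative_compose[where g=f, rotated], rule f, rule inS, use that in \<open>auto intro!: derivative_eq_intros\<close>)
    have "\<exists>s\<in>{0<..<1}. h 1 - h 0 = (\<lambda>x. f' (w + t *\<^sub>R u + (s * t) *\<^sub>R v) ((x * t) *\<^sub>R v) 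
        - f' (w + (s * t) *\<^sub>R v) ((x * t) *\<^sub>R v)) (1 - 0)"
      by (rule mvt_simple) (use hd in \<open>auto intro: has_derivative_at_withinI\<close>)
    then obtain s where s: "0 < s" "s < 1" and hs: "h 1 - h 0 = 
        f' (w + t *\<^sub>R u + (s * t) *\<^sub>R v) (t *\<^sub>R v) - f' (w + (s * t) *\<^sub>R v) (t *\<^sub>R v)" by auto
    define a where "a = t *\<^sub>R u + (s * t) *\<^sub>R v"
    define b where "b = (s * t) *\<^sub>R v"
    have l1: "linear (f' (w + a))" "linear (f' (w + b))"
      using f inS[of s] s by (auto intro!: has_derivative_linear simp: a_def b_def add.assoc)
    have hs': "h 1 - h 0 = t * (f' (w + a) v - f' (w + b) v)"
      using hs l1 by (simp add: a_def b_def add.assoc linear_cmul right_diff_distrib)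
    have na: "norm a \<le> t * (norm u + norm v)" "norm b \<le> t * norm v"
      using n1[of s] n2[of s] s by (auto simp: a_def b_def)
    have A: "\<bar>f' (w + a) v - f' w v - g a\<bar> \<le> (\<epsilon> / (2 * C)) * norm a"
      using d(2)[of "w + a"] na le tC by auto
    have B: "\<bar>f' (w + b) v - f' w v - g b\<bar> \<le> (\<epsilon> / (2 * C)) * norm b"
      using d(2)[of "w + b"] na le tC by auto
    \<comment> \<open>The intermediate parameter \<open>s\<close> cancels, since
      \<open>a - b\<close> is \<open>t\<close> times \<open>u\<close>.\<close>
    have gab: "g a - g b = t * g u" using lin by (simp add: a_def b_def linear_add linear_cmul)
    have "\<bar>f' (w + a) v - f' (w + b) v - t * g u\<bar> \<le> (\<epsilon> / (2 * C)) * (norm a + norm b)"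
      using A B gab by (simp add: distrib_left)
    also have "\<dots> \<le> (\<epsilon> / (2 * C)) * (t * C)"
      using na t \<open>\<epsilon> > 0\<close> C by (intro mult_left_mono) (auto simp: C_def algebra_simps)
    also have "\<dots> < \<epsilon> * t" using C t \<open>\<epsilon> > 0\<close> by (simp add: field_simps)
    finally have fin: "\<bar>f' (w + a) v - f' (w + b) v - t * g u\<bar> < \<epsilon> * t" .
    have "(f (w + t *\<^sub>R u + t *\<^sub>R v) - f (w + t *\<^sub>R u) - f (w + t *\<^sub>R v) + f w) / t\<^sup>2 - g u
        = (h 1 - h 0) / t\<^sup>2 - g u" by (simp add: h_def)
    also have "\<dots> = (f' (w + a) v - f' (w + b) v - t * g u) / t"
      using t unfolding hs' by (simp add: field_simps power2_eq_square)
    finally show ?thesis using fin t by (simp add: dist_real_def pos_divide_less_eq)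
  qed
  show "\<forall>\<^sub>F t in at_right 0. dist ((f (w + t *\<^sub>R u + t *\<^sub>R v) - f (w + t *\<^sub>R u) - f (w + t *\<^sub>R v) + f w) / t\<^sup>2) (g u) < \<epsilon>"
    unfolding eventually_at_right_field using \<open>\<delta> > 0\<close> main by auto
qed

text \<open>Exchanging \<open>u\<close> and \<open>v\<close> leaves the second difference unchanged,
  so its two limits agree.\<close>

lemma second_derivative_symmetric:
  fixes f :: "'a::real_normed_vector \<Rightarrow> real"
  assumes "open S" "w \<in> S" and f: "\<And>x. x \<in> S \<Longrightarrow> (f has_derivative f' x) (at x)"
    and g: "((\<lambda>x. f' x v) has_derivative g) (at w)"
    and k: "((\<lambda>x. f' x u) has_derivative k) (at w)"
  shows "g u = k v"
proof -
  have "((\<lambda>t. (f (w + t *\<^sub>R u + t *\<^sub>R v) - f (w + t *\<^sub>R u) - f (w + t *\<^sub>R v) + f w) / t\<^sup>2)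
           \<longlongrightarrow> k v) (at_right 0)"
    using second_difference_tendsto[OF assms(1,2) f k, of v] by (simp add: algebra_simps)
  then show ?thesis
    using second_difference_tendsto[OF assms(1,2) f g, of u] tendsto_unique trivial_limit_at_right_real by blast
qed

text \<open>If \<open>L\<close> were positive, \<open>g'\<close> would vanish at 0 and be positive
  just to the right of it, so \<open>g\<close> would rise above \<open>g 0\<close> by the mean value
  theorem.\<close>

lemma local_max_second_derivative_nonpos:
  fixes g :: "real \<Rightarrow> real"
  assumes "\<epsilon> > 0"
    and g: "\<And>t. \<bar>t\<bar> < \<epsilon> \<Longrightarrow> (g has_real_derivative g' t) (at t)"
    and g': "(g' has_real_derivative L) (at 0)"
    and max: "\<And>t. \<bar>t\<bar> < \<epsilon> \<Longrightarrow> g t \<le> g 0"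
  shows "L \<le> 0"
proof (rule ccontr)
  assume "\<not> L \<le> 0"
  then obtain d where d: "d > 0" "\<And>h. 0 < h \<Longrightarrow> h < d \<Longrightarrow> g' 0 < g' h"
    using DERIV_pos_inc_right[OF g', of] by auto
  have 0: "g' 0 = 0"
    using DERIV_local_max[OF g[of 0], of \<epsilon>] max \<open>\<epsilon> > 0\<close> by auto
  define h where "h = min d \<epsilon> / 2"
  have h: "0 < h" "h < d" "h < \<epsilon>" using d \<open>\<epsilon> > 0\<close> by (auto simp: h_def)
  obtain z where "0 < z" "z < h" "g h - g 0 = (h - 0) * g' z"
    using MVT2[of 0 h g g'] g h by auto
  then have "g h > g 0" using d(2)[of z] 0 h by (smt (verit) mult_pos_pos)
  then show False using max[of h] h by auto
qed


section \<open>Smooth maps and their partial derivatives\<close>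

lemma smooth_on_differentiable: "smooth_on f S \<Longrightarrow> x \<in> S \<Longrightarrow> f differentiable (at x)"
  unfolding smooth_on_def by (metis Ck_on.simps(2))

lemma smooth_on_frechet_derivative:
  "smooth_on f S \<Longrightarrow> smooth_on (\<lambda>x. frechet_derivative f (at x) v) S"
  unfolding smooth_on_def by (metis Ck_on.simps(2))

lemma smooth_on_has_derivative:
  "smooth_on f S \<Longrightarrow> x \<in> S \<Longrightarrow> (f has_derivative frechet_derivative f (at x)) (at x)"
  using frechet_derivative_works smooth_on_differentiable by blast

lemma smooth_on_partial_deriv: "smooth_on X W \<Longrightarrow> smooth_on (partial_deriv i X) W"
  unfolding partial_deriv_def by (rule smooth_on_frechet_derivative)

lemma axis_expansion_2: "(v::real^2) = v $ 1 *\<^sub>R axis 1 1 + v $ 2 *\<^sub>R axis 2 1"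
  by (simp add: vec_eq_iff forall_2 axis_def)

lemma frechet_derivative_partial_deriv:
  assumes "X differentiable (at w)"
  shows "frechet_derivative X (at w) v = v $ 1 *\<^sub>R partial_deriv 1 X w + v $ 2 *\<^sub>R partial_deriv 2 X w"
proof -
  have "linear (frechet_derivative X (at w))" using assms by (rule linear_frechet_derivative)
  then show ?thesis unfolding partial_deriv_def
    by (subst axis_expansion_2[of v]) (simp add: linear_add linear_cmul)
qed

text \<open>The symmetry result is for real functions, so it is applied to
  \<open>X x \<bullet> c\<close> for every vector \<open>c\<close>.\<close>

lemma partial_deriv_commute:
  assumes "open W" "smooth_on X W" "w \<in> W"
  shows "partial_deriv i (partial_deriv j X) w = partial_deriv j (partial_deriv i X) w"
proof -
  have *: "((\<lambda>x. partial_deriv k X x \<bullet> c) has_derivative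
      (\<lambda>h. frechet_derivative (partial_deriv k X) (at w) h \<bullet> c)) (at w)" for k c
    using smooth_on_has_derivative[OF smooth_on_partial_deriv[OF assms(2)] assms(3)]
    by (intro has_derivative_inner_left)
  have "partial_deriv i (partial_deriv j X) w \<bullet> c = partial_deriv j (partial_deriv i X) w \<bullet> c" for c
    unfolding partial_deriv_def[of _ "partial_deriv _ _"]
    using second_derivative_symmetric[OF assms(1,3), of "\<lambda>x. X x \<bullet> c"
      "\<lambda>x h. frechet_derivative X (at x) h \<bullet> c" "axis j 1" _ "axis i 1"]
      *[of j c] *[of i c] smooth_on_has_derivative[OF assms(2)]
    by (auto simp: partial_deriv_def intro!: has_derivative_inner_left)
  then show ?thesis by (metis vector_eq_rdot)
qed

section \<open>Minimality in a chart and interior maxima\<close>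

lemma local_param_smooth: "local_param M X W \<Longrightarrow> smooth_on X W"
  and local_param_open: "local_param M X W \<Longrightarrow> open W"
  by (auto simp: local_param_def)

text \<open>A linear dependence between the partial derivatives would put a nonzero vector into the
  kernel of the injective differential.\<close>

lemma cross_partial_deriv_nonzero:
  assumes "local_param M X W" "w \<in> W \<inter> half_plane"
  shows "cross3 (partial_deriv 1 X w) (partial_deriv 2 X w) \<noteq> 0"
proof
  let ?D = "frechet_derivative X (at w)"
  have diff: "X differentiable (at w)"
    using assms smooth_on_differentiable local_param_smooth by blast
  have "inj ?D" using assms by (auto simp: local_param_def)
  then have zero: "v = 0" if "?D v = 0" for v
    using that linear_frechet_derivative[OF diff] by (metis injD linear_0)
  note D = frechet_derivative_partial_deriv[OF diff]
  assume "cross3 (partial_deriv 1 X w) (partial_deriv 2 X w) = 0"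
  then consider "partial_deriv 1 X w = 0" | "partial_deriv 2 X w = 0"
    | c where "partial_deriv 2 X w = c *\<^sub>R partial_deriv 1 X w"
    by (auto simp: cross_eq_0 collinear_lemma)
  then show False
  proof cases
    case 1
    then show False using zero[of "axis 1 1"] by (simp add: D axis_def vec_eq_iff forall_2)
  next
    case 2
    then show False using zero[of "axis 2 1"] by (simp add: D axis_def vec_eq_iff forall_2)
  next
    case 3
    then show False using zero[of "vector [c, -1]"] by (simp add: D vec_eq_iff forall_2)
  qed
qed

text \<open>This is the mean curvature equation cleared of its denominators:
  \<open>E G - F^2\<close> is the squared norm of the cross product by Lagrange's identity, hence
  nonzero. In an arbitrary chart only the normal component of this trace vanishes.\<close>

lemma minimal_surface_trace:
  assumes "minimal_surface M" "local_param M X W" "w \<in> W \<inter> half_plane"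
  defines "X1 \<equiv> partial_deriv 1 X w" and "X2 \<equiv> partial_deriv 2 X w"
  shows "((X2 \<bullet> X2) *\<^sub>R partial_deriv 1 (partial_deriv 1 X) w
          - (2 * (X1 \<bullet> X2)) *\<^sub>R partial_deriv 1 (partial_deriv 2 X) w
          + (X1 \<bullet> X1) *\<^sub>R partial_deriv 2 (partial_deriv 2 X) w) \<bullet> cross3 X1 X2 = 0"
proof -
  let ?N = "cross3 X1 X2"
  have N: "?N \<noteq> 0" unfolding X1_def X2_def using cross_partial_deriv_nonzero assms by blast
  have "(X1 \<bullet> X1) * (X2 \<bullet> X2) - (X1 \<bullet> X2)\<^sup>2 = (norm ?N)\<^sup>2"
    using norm_cross_dot[of X1 X2] by (simp add: power_mult_distrib dot_square_norm)
  moreover have "mean_curvature_vector X w = 0" using assms unfolding minimal_surface_def by blast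
  ultimately have "second_form X 1 1 w * (X2 \<bullet> X2) - 2 * second_form X 1 2 w * (X1 \<bullet> X2)
      + second_form X 2 2 w * (X1 \<bullet> X1) = 0"
    using N by (simp add: mean_curvature_vector_def unit_normal_def sgn_zero_iff first_form_def
        flip: X1_def X2_def)
  then have "inverse (norm ?N) * (((X2 \<bullet> X2) *\<^sub>R partial_deriv 1 (partial_deriv 1 X) w
          - (2 * (X1 \<bullet> X2)) *\<^sub>R partial_deriv 1 (partial_deriv 2 X) w
          + (X1 \<bullet> X1) *\<^sub>R partial_deriv 2 (partial_deriv 2 X) w) \<bullet> ?N) = 0"
    unfolding second_form_def unit_normal_def sgn_div_norm X1_def[symmetric] X2_def[symmetric]
    by (simp add: inner_add_left inner_diff_left algebra_simps)
  then show ?thesis using N by simp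
qed

text \<open>In three dimensions, a vector orthogonal to the independent vectors \<open>a\<close> and
  \<open>b\<close> is a multiple of their cross product.\<close>

lemma inner_orthogonal_span_cross:
  fixes a b c d :: "real^3"
  assumes "cross3 a b \<noteq> 0" "c \<bullet> a = 0" "c \<bullet> b = 0" "d \<bullet> cross3 a b = 0"
  shows "c \<bullet> d = 0"
proof -
  have "cross3 c (cross3 a b) = 0"
    using assms(2,3) by (simp add: Lagrange)
  then obtain k where "c = k *\<^sub>R cross3 a b"
    using assms(1) by (metis collinear_lemma cross_eq_0 cross_skew minus_equation_iff scaleR_zero_left neg_equal_0_iff_equal)
  then show ?thesis using assms(4) by (simp add: inner_commute)
qed

text \<open>Restricted to the line through \<open>w\<close> in direction \<open>v\<close>, the
  composite of \<open>\<phi>\<close> and \<open>X\<close> has a maximum at \<open>w\<close>, and the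
  left-hand side is its second derivative there. \<open>Gr\<close> and \<open>H\<close> are the
  gradient and the Hessian of \<open>\<phi>\<close>; the gradient term accounts for the bending of
  \<open>X\<close>.\<close>

lemma second_derivative_at_max:
  fixes \<phi> :: "real^3 \<Rightarrow> real" and X :: "real^2 \<Rightarrow> real^3" and v :: "real^2"
  assumes "open W" "smooth_on X W" "w \<in> W"
    and \<phi>: "\<And>x. (\<phi> has_derivative (\<lambda>h. Gr x \<bullet> h)) (at x)"
    and Gr: "\<And>x. (Gr has_derivative H x) (at x)"
    and max: "\<forall>\<^sub>F y in nhds w. \<phi> (X y) \<le> \<phi> (X w)"
  defines "V \<equiv> frechet_derivative X (at w) v"
  shows "H (X w) V \<bullet> V + Gr (X w) \<bullet> frechet_derivative (\<lambda>x. frechet_derivative X (at x) v) (at w) v \<le> 0"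
proof -
  have "\<forall>\<^sub>F y in nhds w. y \<in> W \<and> \<phi> (X y) \<le> \<phi> (X w)"
    using max assms(1,3) eventually_nhds_in_open eventually_conj by blast
  then obtain r where r: "r > 0" "\<And>y. dist y w < r \<Longrightarrow> y \<in> W \<and> \<phi> (X y) \<le> \<phi> (X w)"
    unfolding eventually_nhds_metric by blast
  define \<epsilon> where "\<epsilon> = r / (norm v + 1)"
  have \<epsilon>: "\<epsilon> > 0" using r by (simp add: \<epsilon>_def add_nonneg_pos)
  have near: "dist (w + t *\<^sub>R v) w < r" if "\<bar>t\<bar> < \<epsilon>" for t
  proof -
    have "\<bar>t\<bar> * norm v \<le> \<bar>t\<bar> * (norm v + 1)" by (intro mult_left_mono) auto
    also have "\<dots> < \<epsilon> * (norm v + 1)" using that by (intro mult_strict_right_mono) (auto simp: add_nonneg_pos)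
    also have "\<dots> = r" unfolding \<epsilon>_def using norm_ge_zero[of v] by (smt (verit) nonzero_eq_divide_eq)
    finally show ?thesis by (simp add: dist_norm)
  qed
  have line: "((\<lambda>t. w + t *\<^sub>R v) has_derivative (\<lambda>h. h *\<^sub>R v)) (at t)" for t :: real
    by (auto intro!: derivative_eq_intros)
  define g' where "g' t = Gr (X (w + t *\<^sub>R v)) \<bullet> frechet_derivative X (at (w + t *\<^sub>R v)) v" for t :: real
  have X': "((\<lambda>t. X (w + t *\<^sub>R v)) has_derivative (\<lambda>h. frechet_derivative X (at (w + t *\<^sub>R v)) (h *\<^sub>R v))) (at t)"
    if "\<bar>t\<bar> < \<epsilon>" for t
    using has_derivative_compose[OF line smooth_on_has_derivative[OF assms(2)]] near[OF that] r(2) by blast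
  have X'l: "frechet_derivative X (at (w + t *\<^sub>R v)) (h *\<^sub>R v) = h *\<^sub>R frechet_derivative X (at (w + t *\<^sub>R v)) v"
    if "\<bar>t\<bar> < \<epsilon>" for t h
    using linear_frechet_derivative[OF smooth_on_differentiable[OF assms(2)]] near[OF that] r(2)
      linear_cmul by blast
  show ?thesis
  proof (rule local_max_second_derivative_nonpos[OF \<epsilon>, of "\<lambda>t. \<phi> (X (w + t *\<^sub>R v))" g'])
    fix t :: real assume t: "\<bar>t\<bar> < \<epsilon>"
    show "((\<lambda>t. \<phi> (X (w + t *\<^sub>R v))) has_real_derivative g' t) (at t)"
      unfolding has_field_derivative_def g'_def
      using has_derivative_compose[OF X'[OF t] \<phi>] by (simp add: X'l[OF t] mult_commute_abs)
    show "\<phi> (X (w + t *\<^sub>R v)) \<le> \<phi> (X (w + 0 *\<^sub>R v))" using near[OF t] r(2) by simp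
  next
    let ?Dv = "\<lambda>x. frechet_derivative X (at x) v"
    have 1: "((\<lambda>t. Gr (X (w + t *\<^sub>R v))) has_derivative (\<lambda>h. H (X w) (h *\<^sub>R V))) (at 0)"
      using has_derivative_compose[OF X'[of 0] Gr] X'l[of 0] \<epsilon> by (simp add: V_def)
    have 2: "((\<lambda>t. ?Dv (w + t *\<^sub>R v)) has_derivative (\<lambda>h. frechet_derivative ?Dv (at w) (h *\<^sub>R v))) (at 0)"
      using has_derivative_compose[OF line[of 0], of ?Dv]
        smooth_on_has_derivative[OF smooth_on_frechet_derivative[OF assms(2)] assms(3)] by simp
    have l1: "linear (H (X w))" using Gr has_derivative_linear by blast
    have l2: "linear (frechet_derivative ?Dv (at w))"
      using smooth_on_has_derivative[OF smooth_on_frechet_derivative[OF assms(2)] assms(3)] has_derivative_linear by blast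
    show "(g' has_real_derivative H (X w) V \<bullet> V + Gr (X w) \<bullet> frechet_derivative ?Dv (at w) v) (at 0)"
      unfolding has_field_derivative_def g'_def[abs_def]
      by (rule has_derivative_eq_rhs[OF has_derivative_inner[OF 1 2]])
        (simp add: fun_eq_iff linear_cmul[OF l1] linear_cmul[OF l2] V_def algebra_simps)
  qed
qed


lemma second_directional_derivative:
  assumes "open W" "smooth_on X W" "w \<in> W"
  shows "frechet_derivative (\<lambda>x. frechet_derivative X (at x) v) (at w) v =
    (v $ 1)\<^sup>2 *\<^sub>R partial_deriv 1 (partial_deriv 1 X) w
    + (2 * v $ 1 * v $ 2) *\<^sub>R partial_deriv 1 (partial_deriv 2 X) w
    + (v $ 2)\<^sup>2 *\<^sub>R partial_deriv 2 (partial_deriv 2 X) w"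
proof -
  let ?D = "\<lambda>i. frechet_derivative (partial_deriv i X) (at w)"
  have "((\<lambda>x. v $ 1 *\<^sub>R partial_deriv 1 X x + v $ 2 *\<^sub>R partial_deriv 2 X x)
      has_derivative (\<lambda>h. v $ 1 *\<^sub>R ?D 1 h + v $ 2 *\<^sub>R ?D 2 h)) (at w)"
    using smooth_on_has_derivative[OF smooth_on_partial_deriv[OF assms(2)] assms(3)]
    by (intro has_derivative_add has_derivative_scaleR_right)
  then have "((\<lambda>x. frechet_derivative X (at x) v)
      has_derivative (\<lambda>h. v $ 1 *\<^sub>R ?D 1 h + v $ 2 *\<^sub>R ?D 2 h)) (at w)"
    using assms(1,3)
  proof (rule has_derivative_transform_within_open)
    fix x assume "x \<in> W"
    then show "v $ 1 *\<^sub>R partial_deriv 1 X x + v $ 2 *\<^sub>R partial_deriv 2 X x = frechet_derivative X (at x) v"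
      using frechet_derivative_partial_deriv[OF smooth_on_differentiable[OF assms(2)]] by metis
  qed
  then have "frechet_derivative (\<lambda>x. frechet_derivative X (at x) v) (at w) v
      = v $ 1 *\<^sub>R ?D 1 v + v $ 2 *\<^sub>R ?D 2 v"
    by (simp flip: frechet_derivative_at)
  also have "\<dots> = v $ 1 *\<^sub>R (v $ 1 *\<^sub>R partial_deriv 1 (partial_deriv 1 X) w + v $ 2 *\<^sub>R partial_deriv 2 (partial_deriv 1 X) w)
     + v $ 2 *\<^sub>R (v $ 1 *\<^sub>R partial_deriv 1 (partial_deriv 2 X) w + v $ 2 *\<^sub>R partial_deriv 2 (partial_deriv 2 X) w)"
    using frechet_derivative_partial_deriv[OF smooth_on_differentiable[OF smooth_on_partial_deriv[OF assms(2)] assms(3)]]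
    by simp
  finally show ?thesis using partial_deriv_commute[OF assms, of 2 1]
    by (simp add: vec_eq_iff power2_eq_square algebra_simps)
qed

lemma differentiable_critical_at_max:
  fixes f :: "'a::euclidean_space \<Rightarrow> real"
  assumes "(f has_derivative f') (at w)" "\<forall>\<^sub>F y in nhds w. f y \<le> f w"
  shows "f' = (\<lambda>h. 0)"
proof -
  obtain r where "r > 0" "\<And>y. y \<in> ball w r \<Longrightarrow> f y \<le> f w"
    using assms(2) unfolding eventually_nhds_metric by (auto simp: dist_commute)
  then show ?thesis using differential_zero_maxmin[of w "ball w r" f f'] assms(1) by auto
qed

text \<open>At such a maximum the gradient of \<open>\<phi>\<close> is normal to the surface, so by
  minimality the second derivatives of \<open>X\<close> drop out of the trace. The vector
  \<open>V k\<close> is the cross product of the \<open>k\<close>-th coordinate vector with the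
  normal \<open>cross3 X1 X2\<close>; the sum is therefore the trace of the Hessian over the tangent
  plane, times the squared norm of that normal.\<close>

lemma minimal_surface_trace_hessian_nonpos:
  assumes "minimal_surface M" "local_param M X W" "w \<in> W \<inter> half_plane"
    and \<phi>: "\<And>x. (\<phi> has_derivative (\<lambda>h. Gr x \<bullet> h)) (at x)"
    and Gr: "\<And>x. (Gr has_derivative H x) (at x)"
    and max: "\<forall>\<^sub>F y in nhds w. \<phi> (X y) \<le> \<phi> (X w)"
  defines "V \<equiv> \<lambda>k. partial_deriv 2 X w $ k *\<^sub>R partial_deriv 1 X w - partial_deriv 1 X w $ k *\<^sub>R partial_deriv 2 X w"
  shows "(\<Sum>k\<in>UNIV. H (X w) (V k) \<bullet> V k) \<le> 0"
proof -
  define X1 X2 where "X1 = partial_deriv 1 X w" and "X2 = partial_deriv 2 X w"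
  define X11 X12 X22 where "X11 = partial_deriv 1 (partial_deriv 1 X) w"
    and "X12 = partial_deriv 1 (partial_deriv 2 X) w" and "X22 = partial_deriv 2 (partial_deriv 2 X) w"
  have W: "open W" "smooth_on X W" "w \<in> W"
    using assms local_param_open local_param_smooth by auto
  note D = frechet_derivative_partial_deriv[OF smooth_on_differentiable[OF W(2,3)], folded X1_def X2_def]
  have "((\<lambda>y. \<phi> (X y)) has_derivative (\<lambda>h. Gr (X w) \<bullet> frechet_derivative X (at w) h)) (at w)"
    using has_derivative_compose[OF smooth_on_has_derivative[OF W(2,3)] \<phi>] .
  then have "(\<lambda>h. Gr (X w) \<bullet> frechet_derivative X (at w) h) = (\<lambda>h. 0)"
    using max by (rule differentiable_critical_at_max)
  then have crit: "Gr (X w) \<bullet> frechet_derivative X (at w) h = 0" for h by metis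
  have "Gr (X w) \<bullet> X1 = 0" "Gr (X w) \<bullet> X2 = 0"
    using crit[of "axis 1 1"] crit[of "axis 2 1"] by (simp_all add: D axis_def)
  then have Gr0: "Gr (X w) \<bullet> ((X2 \<bullet> X2) *\<^sub>R X11 - (2 * (X1 \<bullet> X2)) *\<^sub>R X12 + (X1 \<bullet> X1) *\<^sub>R X22) = 0"
    using inner_orthogonal_span_cross cross_partial_deriv_nonzero[OF assms(2,3)]
      minimal_surface_trace[OF assms(1-3)]
    unfolding X1_def X2_def X11_def X12_def X22_def by blast
  \<comment> \<open>The trace of a quadratic form \<open>Q\<close> against the matrix of cofactors of the first fundamental form
    is \<open>\<Sum>k. Q (v k)\<close>, where \<open>v k\<close> is the rotation by a right angle of the pair of \<open>k\<close>-th coordinates of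
    \<open>X1\<close> and \<open>X2\<close>.\<close>
  define v where "v k = (vector [X2 $ k, - X1 $ k] :: real^2)" for k
  have Dv: "frechet_derivative X (at w) (v k) = V k" for k
    unfolding D V_def X1_def[symmetric] X2_def[symmetric] by (simp add: v_def)
  have "H (X w) (V k) \<bullet> V k + Gr (X w) \<bullet> ((X2 $ k)\<^sup>2 *\<^sub>R X11 + (- 2 * X2 $ k * X1 $ k) *\<^sub>R X12 + (X1 $ k)\<^sup>2 *\<^sub>R X22) \<le> 0" for k
    using second_derivative_at_max[OF W \<phi> Gr max, of "v k"]
    unfolding second_directional_derivative[OF W] Dv by (simp add: v_def X11_def X12_def X22_def)
  then have "(\<Sum>k\<in>UNIV. H (X w) (V k) \<bullet> V k
      + Gr (X w) \<bullet> ((X2 $ k)\<^sup>2 *\<^sub>R X11 + (- 2 * X2 $ k * X1 $ k) *\<^sub>R X12 + (X1 $ k)\<^sup>2 *\<^sub>R X22)) \<le> 0"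
    by (rule sum_nonpos)
  moreover have "(\<Sum>k\<in>UNIV. Gr (X w) \<bullet> ((X2 $ k)\<^sup>2 *\<^sub>R X11 + (- 2 * X2 $ k * X1 $ k) *\<^sub>R X12 + (X1 $ k)\<^sup>2 *\<^sub>R X22))
      = Gr (X w) \<bullet> ((X2 \<bullet> X2) *\<^sub>R X11 - (2 * (X1 \<bullet> X2)) *\<^sub>R X12 + (X1 \<bullet> X1) *\<^sub>R X22)"
    unfolding inner_vec_def[of X1] inner_vec_def[of X2] sum_3
    by (simp add: inner_add_right inner_diff_right power2_eq_square algebra_simps)
  ultimately show ?thesis using Gr0 by (simp add: sum.distrib)
qed

section \<open>Maxima at the boundary and the free boundary condition\<close>

text \<open>From a boundary point one may move both ways along the boundary, but only inwards in the
  first coordinate.\<close>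

lemma half_plane_max:
  fixes f :: "real^2 \<Rightarrow> real"
  assumes f: "(f has_derivative f') (at w)" and w: "w $ 1 = 0"
    and max: "\<forall>\<^sub>F y in nhds w. y \<in> half_plane \<longrightarrow> f y \<le> f w"
  shows "f' (axis 2 1) = 0" "f' (axis 1 1) \<le> 0"
proof -
  obtain r where r: "r > 0" "\<And>y. dist y w < r \<Longrightarrow> y \<in> half_plane \<Longrightarrow> f y \<le> f w"
    using max unfolding eventually_nhds_metric by blast
  have line: "((\<lambda>t. f (w + t *\<^sub>R v)) has_real_derivative f' v) (at 0)" for v
  proof -
    have "((\<lambda>t. f (w + t *\<^sub>R v)) has_derivative (\<lambda>h. f' (h *\<^sub>R v))) (at 0)"
      by (rule has_derivative_compose[where g=f]) (use f in \<open>auto intro!: derivative_eq_intros\<close>)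
    moreover have "(\<lambda>h. f' (h *\<^sub>R v)) = (*) (f' v)"
      using linear_cmul[OF has_derivative_linear[OF f]] by (simp add: fun_eq_iff mult.commute)
    ultimately show ?thesis unfolding has_field_derivative_def by simp
  qed
  have move: "f (w + t *\<^sub>R axis i 1) \<le> f w" if "\<bar>t\<bar> < r" "i = 1 \<Longrightarrow> 0 \<le> t" for i t
  proof (rule r(2))
    show "dist (w + t *\<^sub>R axis i 1) w < r" using that by (simp add: dist_norm)
    show "w + t *\<^sub>R axis i 1 \<in> half_plane" using that w by (simp add: half_plane_def axis_def)
  qed
  show "f' (axis 2 1) = 0"
    using DERIV_local_max[OF line r(1)] move[of _ 2] by simp
  show "f' (axis 1 1) \<le> 0"
  proof (rule ccontr)
    assume "\<not> f' (axis 1 1) \<le> 0"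
    then obtain d where d: "d > 0" "\<And>h. 0 < h \<Longrightarrow> h < d \<Longrightarrow> f w < f (w + h *\<^sub>R axis 1 1)"
      using DERIV_pos_inc_right[OF line, of "axis 1 1"] by auto
    have "min d r / 2 > 0" "min d r / 2 < d" "min d r / 2 < r" using d r by auto
    then show False using d(2)[of "min d r / 2"] move[of "min d r / 2" 1] by auto
  qed
qed

text \<open>Orthogonality to the sphere places the position vector in the tangent plane. Since
  \<open>M\<close> lies in the ball, the squared norm is maximal at \<open>w\<close>, so
  \<open>X w\<close> is orthogonal to the boundary direction and does not point inwards. Thus
  derivatives in direction \<open>X w\<close> are outward derivatives on the surface.\<close>

lemma free_boundary_outward_position:
  assumes M: "embedded_compact_free_boundary_minimal_surface M"
    and lp: "local_param M X W" and w: "w \<in> W" "w $ 1 = 0"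
  obtains \<alpha> \<beta> where "\<alpha> < 0" "X w = \<alpha> *\<^sub>R partial_deriv 1 X w + \<beta> *\<^sub>R partial_deriv 2 X w"
proof -
  define X1 X2 where "X1 = partial_deriv 1 X w" and "X2 = partial_deriv 2 X w"
  let ?N = "cross3 X1 X2"
  have wH: "w \<in> W \<inter> half_plane" using w by (simp add: half_plane_def)
  have N: "?N \<noteq> 0" using cross_partial_deriv_nonzero[OF lp wH] by (simp add: X1_def X2_def)
  have "X w \<in> surface_boundary M" unfolding surface_boundary_def using lp w by blast
  then have nX: "norm (X w) = 1"
    using M by (auto simp: embedded_compact_free_boundary_minimal_surface_def)
  have "orthogonal (unit_normal X w) (X w)"
    using M lp w by (auto simp: embedded_compact_free_boundary_minimal_surface_def meets_sphere_orthogonally_def)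
  then have XN: "X w \<bullet> ?N = 0"
    using N by (simp add: unit_normal_def orthogonal_def sgn_div_norm inner_commute flip: X1_def X2_def)
  have D: "(X has_derivative frechet_derivative X (at w)) (at w)"
    using smooth_on_has_derivative[OF local_param_smooth[OF lp] w(1)] .
  have X_sq: "((\<lambda>y. X y \<bullet> X y) has_derivative
      (\<lambda>h. X w \<bullet> frechet_derivative X (at w) h + frechet_derivative X (at w) h \<bullet> X w)) (at w)"
    by (rule has_derivative_inner[OF D D])
  have X_sq_max: "\<forall>\<^sub>F y in nhds w. y \<in> half_plane \<longrightarrow> X y \<bullet> X y \<le> X w \<bullet> X w"
    using eventually_nhds_in_open[OF local_param_open[OF lp] w(1)]
  proof (rule eventually_mono, intro impI)
    fix y assume "y \<in> W" "y \<in> half_plane"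
    then have "X y \<in> M" using lp openin_imp_subset unfolding local_param_def by blast
    then have "norm (X y) \<le> 1"
      using M by (auto simp: embedded_compact_free_boundary_minimal_surface_def)
    then show "X y \<bullet> X y \<le> X w \<bullet> X w" using nX by (simp add: dot_square_norm abs_square_le_1)
  qed
  have X2: "X w \<bullet> X2 = 0" and X1: "X w \<bullet> X1 \<le> 0"
    using half_plane_max[OF X_sq w(2) X_sq_max] by (auto simp: X1_def X2_def partial_deriv_def inner_commute)
  \<comment> \<open>Crossing twice with the normal recovers the tangent vector \<open>X w\<close> up
    to scale and expresses it through the two partial derivatives.\<close>
  have "(?N \<bullet> ?N) *\<^sub>R X w = (X w \<bullet> X1) *\<^sub>R ((X2 \<bullet> X2) *\<^sub>R X1 - (X1 \<bullet> X2) *\<^sub>R X2)"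
  proof -
    have "(?N \<bullet> ?N) *\<^sub>R X w = cross3 ?N (cross3 (X w) ?N)"
      using XN Lagrange[of ?N "X w" ?N] by (simp add: inner_commute)
    also have "cross3 (X w) ?N = - (X w \<bullet> X1) *\<^sub>R X2" using X2 by (simp add: Lagrange)
    also have "cross3 ?N \<dots> = (X w \<bullet> X1) *\<^sub>R cross3 X2 ?N"
      by (simp add: cross_mult_right cross_skew[of ?N])
    finally show ?thesis by (simp add: Lagrange inner_commute)
  qed
  then have eq: "X w = (1 / (?N \<bullet> ?N)) *\<^sub>R ((X w \<bullet> X1) *\<^sub>R ((X2 \<bullet> X2) *\<^sub>R X1 - (X1 \<bullet> X2) *\<^sub>R X2))"
    using N by (metis (no_types, lifting) divide_inverse inner_eq_zero_iff mult_1 scaleR_left_imp_eq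
        scaleR_scaleR scaleR_one right_inverse)
  have "X w \<bullet> X1 \<noteq> 0"
  proof
    assume 0: "X w \<bullet> X1 = 0"
    show False using eq nX unfolding 0 by simp
  qed
  moreover have "X2 \<noteq> 0" using N by auto
  ultimately have "(X w \<bullet> X1) * (X2 \<bullet> X2) / (?N \<bullet> ?N) < 0"
    using X1 N by (intro divide_neg_pos mult_neg_pos) auto
  moreover have "X w = ((X w \<bullet> X1) * (X2 \<bullet> X2) / (?N \<bullet> ?N)) *\<^sub>R X1
      + (- (X w \<bullet> X1) * (X1 \<bullet> X2) / (?N \<bullet> ?N)) *\<^sub>R X2"
    by (subst eq) (simp add: scaleR_diff_right)
  ultimately show ?thesis using that unfolding X1_def X2_def by blast
qed

section \<open>Exclusion of one-sided touching\<close>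

lemma cross_nonzero_independent:
  fixes a b :: "real^3"
  assumes "cross3 a b \<noteq> 0" "x *\<^sub>R a = y *\<^sub>R b"
  shows "x = 0" "y = 0"
proof -
  have "x *\<^sub>R cross3 a b = cross3 (y *\<^sub>R b) b" by (metis assms(2) cross_mult_left)
  then show "x = 0" using assms(1) by (simp add: cross_mult_left)
  have "y *\<^sub>R cross3 a b = cross3 a (x *\<^sub>R a)" by (metis assms(2) cross_mult_right)
  then show "y = 0" using assms(1) by (simp add: cross_mult_right)
qed


text \<open>The half-plane touched is \<open>x \<bullet> n = 0\<close>,
  \<open>x \<bullet> m > 0\<close>. The last clause of \<open>side\<close> encodes that
  \<open>X w0\<close> is nearest to the line among the touching points close to it, and
  \<open>basis\<close> lets the three coordinates separate points.\<close>

lemma no_one_sided_touching_at_nearest_point: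
  fixes m n e :: "real^3"
  assumes M: "embedded_compact_free_boundary_minimal_surface M"
    and lp: "local_param M X W" and w0: "w0 \<in> W \<inter> half_plane"
    and basis: "\<And>x. x \<bullet> m = 0 \<Longrightarrow> x \<bullet> n = 0 \<Longrightarrow> x \<bullet> e = 0 \<Longrightarrow> x = 0"
    and touch: "X w0 \<bullet> n = 0" and pos: "X w0 \<bullet> m > 0"
    and side: "\<forall>\<^sub>F y in nhds w0. y \<in> half_plane \<longrightarrow>
      X y \<bullet> n \<le> 0 \<and> (X y \<bullet> n = 0 \<longrightarrow> X w0 \<bullet> m \<le> X y \<bullet> m)"
  shows False
proof -
  have W: "open W" "smooth_on X W" using lp local_param_open local_param_smooth by auto
  have min: "minimal_surface M" using M by (simp add: embedded_compact_free_boundary_minimal_surface_def)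
  define X1 X2 where "X1 = partial_deriv 1 X" and "X2 = partial_deriv 2 X"
  have N: "cross3 (X1 w) (X2 w) \<noteq> 0" if "w \<in> W \<inter> half_plane" for w
    using cross_partial_deriv_nonzero[OF lp that] by (simp add: X1_def X2_def)
  have X': "(X has_derivative frechet_derivative X (at w)) (at w)" if "w \<in> W" for w
    using smooth_on_has_derivative[OF W(2) that] .
  have lin: "((\<lambda>y. X y \<bullet> c) has_derivative (\<lambda>h. frechet_derivative X (at w) h \<bullet> c)) (at w)" if "w \<in> W" for w c
    using X'[OF that] by (rule has_derivative_inner_left)
  \<comment> \<open>The surface is tangent to the plane at \<open>X w0\<close>. At a boundary point
    the maximum only controls the derivative along the boundary; the other one follows because the
    position vector is tangent to the surface, transversal to its boundary, and orthogonal to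
    \<open>n\<close>.\<close>
  have u: "X1 w0 \<bullet> n = 0" "X2 w0 \<bullet> n = 0"
  proof -
    have "X1 w0 \<bullet> n = 0 \<and> X2 w0 \<bullet> n = 0"
    proof (cases "w0 $ 1 = 0")
      case False
      then have "w0 \<in> {y. y $ 1 > 0}" using w0 by (auto simp: half_plane_def)
      moreover have "open {y::real^2. y $ 1 > 0}"
        by (intro open_Collect_less continuous_intros)
      ultimately have "\<forall>\<^sub>F y in nhds w0. y $ 1 > 0" using eventually_nhds_in_open by fastforce
      then have "\<forall>\<^sub>F y in nhds w0. X y \<bullet> n \<le> X w0 \<bullet> n"
        using side by eventually_elim (auto simp: half_plane_def touch)
      from differentiable_critical_at_max[OF lin this] show ?thesis
        using w0 by (auto simp: X1_def X2_def partial_deriv_def dest: fun_cong)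
    next
      case True
      have "\<forall>\<^sub>F y in nhds w0. y \<in> half_plane \<longrightarrow> X y \<bullet> n \<le> X w0 \<bullet> n"
        using side by eventually_elim (auto simp: touch)
      from half_plane_max(1)[OF lin True this] have X2n: "X2 w0 \<bullet> n = 0"
        using w0 by (auto simp: X2_def partial_deriv_def)
      obtain \<alpha> \<beta> where "\<alpha> < 0" "X w0 = \<alpha> *\<^sub>R X1 w0 + \<beta> *\<^sub>R X2 w0"
        using free_boundary_outward_position[OF M lp _ True] w0 by (auto simp: X1_def X2_def)
      then have "\<alpha> * (X1 w0 \<bullet> n) = 0" using touch X2n by (simp add: inner_add_left)
      then show ?thesis using X2n \<open>\<alpha> < 0\<close> by simp
    qed
    then show "X1 w0 \<bullet> n = 0" "X2 w0 \<bullet> n = 0" by auto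
  qed
  \<comment> \<open>\<open>G c w\<close> is the squared length of the tangential part of
    \<open>c\<close> times the squared norm of the cross product of the partial derivatives.\<close>
  define G where "G c w = (norm ((X1 w \<bullet> c) *\<^sub>R X2 w - (X2 w \<bullet> c) *\<^sub>R X1 w))\<^sup>2" for c w
  \<comment> \<open>Otherwise both partial derivatives would be orthogonal to \<open>m\<close> as
    well as to \<open>n\<close>, leaving only one dimension for the tangent plane.\<close>
  have Gm: "G m w0 > 0"
  proof (rule ccontr)
    assume "\<not> G m w0 > 0"
    then have "(X2 w0 \<bullet> m) *\<^sub>R X1 w0 = (X1 w0 \<bullet> m) *\<^sub>R X2 w0" by (simp add: G_def)
    from cross_nonzero_independent[OF N[OF w0] this]
    have m0: "X1 w0 \<bullet> m = 0" "X2 w0 \<bullet> m = 0" by auto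
    have "(X2 w0 \<bullet> e) *\<^sub>R X1 w0 - (X1 w0 \<bullet> e) *\<^sub>R X2 w0 = 0"
      using u m0 by (intro basis) (auto simp: inner_diff_left)
    then have "(X2 w0 \<bullet> e) *\<^sub>R X1 w0 = (X1 w0 \<bullet> e) *\<^sub>R X2 w0" by simp
    from cross_nonzero_independent[OF N[OF w0] this]
    have "X1 w0 = 0" using u m0 by (intro basis) auto
    then show False using N[OF w0] by simp
  qed
  \<comment> \<open>The 1 makes \<open>A * G m w0 > G e w0\<close> strict, so the Hessian of
    \<open>h\<close> below has positive trace over the tangent plane near \<open>w0\<close>.\<close>
  define A where "A = (G e w0 + 1) / G m w0"
  have A: "A > 0" "A * G m w0 > G e w0" using Gm by (auto simp: A_def G_def intro!: divide_pos_pos add_nonneg_pos)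
  define s0 t0 where "s0 = X w0 \<bullet> m" and "t0 = X w0 \<bullet> e"
  define h where "h x = (s0 - x \<bullet> m) + A * (x \<bullet> m - s0)\<^sup>2 - (x \<bullet> e - t0)\<^sup>2" for x
  \<comment> \<open>\<open>k x\<close> is the derivative of \<open>h\<close> at \<open>x\<close> in
    the radial direction \<open>x\<close>; at \<open>X w0\<close> it equals \<open>- s0\<close>,
    which is negative.\<close>
  define k where "k x = - (x \<bullet> m) + 2 * A * (x \<bullet> m - s0) * (x \<bullet> m) - 2 * (x \<bullet> e - t0) * (x \<bullet> e)" for x
  have contX: "continuous_on W X" "continuous_on W X1" "continuous_on W X2"
    using smooth_on_differentiable[OF W(2)] smooth_on_differentiable[OF smooth_on_partial_deriv[OF W(2)]]
    by (auto simp: X1_def X2_def continuous_on_eq_continuous_at[OF W(1)] intro!: differentiable_imp_continuous_within)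
  have "\<forall>\<^sub>F w in nhds w0. w \<in> W \<and> A * G m w > G e w \<and> A * \<bar>X w \<bullet> m - s0\<bar> < 1 \<and> k (X w) < 0"
  proof -
    have ev: "\<forall>\<^sub>F w in nhds w0. g w > 0" if "continuous_on W g" "g w0 > 0" for g :: "real^2 \<Rightarrow> real"
    proof -
      have "isCont g w0" using that(1) W(1) w0 continuous_on_eq_continuous_at by blast
      then have "(g \<longlongrightarrow> g w0) (nhds w0)" by (simp add: isCont_def tendsto_at_iff_tendsto_nhds)
      then show ?thesis using that(2) by (rule order_tendstoD)
    qed
    have "\<forall>\<^sub>F w in nhds w0. A * G m w - G e w > 0"
      by (rule ev) (use A in \<open>auto simp: G_def intro!: continuous_intros contX\<close>)
    moreover have "\<forall>\<^sub>F w in nhds w0. 1 - A * \<bar>X w \<bullet> m - s0\<bar> > 0"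
      by (rule ev) (auto simp: s0_def intro!: continuous_intros contX)
    moreover have "\<forall>\<^sub>F w in nhds w0. - k (X w) > 0"
      by (rule ev) (use pos in \<open>auto simp: k_def s0_def t0_def intro!: continuous_intros contX\<close>)
    moreover have "\<forall>\<^sub>F w in nhds w0. w \<in> W" using W(1) w0 eventually_nhds_in_open by blast
    ultimately show ?thesis by eventually_elim auto
  qed
  then have "\<forall>\<^sub>F w in nhds w0. (w \<in> W \<and> A * G m w > G e w \<and> A * \<bar>X w \<bullet> m - s0\<bar> < 1 \<and> k (X w) < 0) \<and>
      (w \<in> half_plane \<longrightarrow> X w \<bullet> n \<le> 0 \<and> (X w \<bullet> n = 0 \<longrightarrow> X w0 \<bullet> m \<le> X w \<bullet> m))"
    using side by eventually_elim auto
  then obtain r where r: "r > 0" and near: "\<And>w. dist w w0 < r \<Longrightarrow> w \<in> W" "\<And>w. dist w w0 < r \<Longrightarrow> A * G m w > G e w"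
      "\<And>w. dist w w0 < r \<Longrightarrow> A * \<bar>X w \<bullet> m - s0\<bar> < 1" "\<And>w. dist w w0 < r \<Longrightarrow> k (X w) < 0"
      "\<And>w. dist w w0 < r \<Longrightarrow> w \<in> half_plane \<Longrightarrow> X w \<bullet> n \<le> 0"
      "\<And>w. dist w w0 < r \<Longrightarrow> w \<in> half_plane \<Longrightarrow> X w \<bullet> n = 0 \<Longrightarrow> s0 \<le> X w \<bullet> m"
    unfolding eventually_nhds_metric s0_def by blast
  define \<rho> where "\<rho> = r / 2"
  have \<rho>: "\<rho> > 0" "\<rho> < r" using r by (auto simp: \<rho>_def)
  define K where "K = cball w0 \<rho> \<inter> half_plane"
  have closedH: "closed half_plane" unfolding half_plane_def by (intro closed_Collect_le continuous_intros)
  have K: "compact K" "K \<subseteq> W" "w0 \<in> K"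
    using closedH \<rho> near(1) w0 by (auto simp: K_def dist_commute intro!: compact_Int_closed)
  have contK: "continuous_on K (\<lambda>w. X w \<bullet> n)" "continuous_on K (\<lambda>w. h (X w))"
    unfolding h_def using continuous_on_subset[OF contX(1) K(2)] by (auto intro!: continuous_intros)
  \<comment> \<open>\<open>C\<close> is the part of the rim on which the perturbation could raise
    \<open>x \<bullet> n\<close>; on the rest of the rim the perturbed function is negative for
    every positive \<open>\<epsilon>\<close>.\<close>
  define C where "C = {w \<in> K. h (X w) \<ge> 0} \<inter> sphere w0 \<rho>"
  have "compact C"
  proof -
    have "closed (K \<inter> (\<lambda>w. h (X w)) -` {0..})"
      by (intro continuous_closed_preimage contK(2) compact_imp_closed[OF K(1)] closed_atLeast)
    then have "compact (K \<inter> ((K \<inter> (\<lambda>w. h (X w)) -` {0..}) \<inter> sphere w0 \<rho>))"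
      by (intro compact_Int_closed[OF K(1) closed_Int[OF _ closed_sphere]])
    moreover have "C = K \<inter> ((K \<inter> (\<lambda>w. h (X w)) -` {0..}) \<inter> sphere w0 \<rho>)" by (auto simp: C_def)
    ultimately show ?thesis by simp
  qed
  have C_neg: "X w \<bullet> n < 0" if "w \<in> C" for w
  proof (rule ccontr)
    assume "\<not> X w \<bullet> n < 0"
    have wK: "w \<in> K" "h (X w) \<ge> 0" "dist w w0 = \<rho>" using that by (auto simp: C_def dist_commute)
    have wr: "dist w w0 < r" "w \<in> half_plane" using wK \<rho> by (auto simp: K_def)
    have n0: "X w \<bullet> n = 0" using near(5)[OF wr] \<open>\<not> X w \<bullet> n < 0\<close> by simp
    have le: "s0 \<le> X w \<bullet> m" using near(6)[OF wr n0] .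
    \<comment> \<open>At a touching point \<open>x \<bullet> m \<ge> s0\<close>, and near
      \<open>w0\<close> the linear term of \<open>h\<close> outweighs the quadratic term with
      \<open>A\<close>. Hence \<open>h \<ge> 0\<close> forces all three coordinates to agree with
      those of \<open>X w0\<close>, and injectivity contradicts being on the rim.\<close>
    have "h (X w) = - (X w \<bullet> m - s0) * (1 - A * (X w \<bullet> m - s0)) - (X w \<bullet> e - t0)\<^sup>2"
      by (simp add: h_def power2_eq_square algebra_simps)
    moreover have c: "1 - A * (X w \<bullet> m - s0) > 0" using near(3)[OF wr(1)] le by simp
    moreover have "(X w \<bullet> m - s0) * (1 - A * (X w \<bullet> m - s0)) \<ge> 0"
      using le c by (intro mult_nonneg_nonneg) auto
    moreover have "(X w \<bullet> e - t0)\<^sup>2 \<ge> 0" by simp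
    ultimately have "(X w \<bullet> m - s0) * (1 - A * (X w \<bullet> m - s0)) = 0" "(X w \<bullet> e - t0)\<^sup>2 = 0"
      using wK(2) by linarith+
    then have "X w \<bullet> m = s0 \<and> X w \<bullet> e = t0" using c by simp
    then have "X w - X w0 = 0" using n0 touch by (intro basis) (auto simp: inner_diff_left s0_def t0_def)
    moreover have "inj_on X (W \<inter> half_plane)"
      using lp unfolding local_param_def homeomorphism_def by (metis inj_on_inverseI)
    ultimately have "w = w0" using wr K(2) wK(1) w0 by (auto dest: inj_onD)
    then show False using wK(3) \<rho> by simp
  qed
  obtain \<epsilon> where \<epsilon>: "\<epsilon> > 0" and \<epsilon>C: "\<And>w. w \<in> C \<Longrightarrow> X w \<bullet> n + \<epsilon> * h (X w) \<le> 0"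
  proof (cases "C = {}")
    case True
    then show ?thesis using that[of 1] by simp
  next
    case False
    have CK: "C \<subseteq> K" by (auto simp: C_def)
    obtain p where p: "p \<in> C" "\<And>w. w \<in> C \<Longrightarrow> X w \<bullet> n \<le> X p \<bullet> n"
      using continuous_attains_sup[OF \<open>compact C\<close> False continuous_on_subset[OF contK(1) CK]] by blast
    obtain q where q: "q \<in> C" "\<And>w. w \<in> C \<Longrightarrow> h (X w) \<le> h (X q)"
      using continuous_attains_sup[OF \<open>compact C\<close> False continuous_on_subset[OF contK(2) CK]] by blast
    have hq: "h (X q) \<ge> 0" using q(1) by (simp add: C_def)
    \<comment> \<open>On the compact set \<open>C\<close>, \<open>X p \<bullet> n\<close> is the
      largest, still negative, value of \<open>x \<bullet> n\<close>, and \<open>h (X q)\<close>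
      bounds \<open>h\<close> above; the 1 prevents division by zero.\<close>
    define \<epsilon> where "\<epsilon> = - (X p \<bullet> n) / (h (X q) + 1)"
    have e: "\<epsilon> > 0" unfolding \<epsilon>_def using C_neg[OF p(1)] hq by (intro divide_pos_pos) auto
    have "X w \<bullet> n + \<epsilon> * h (X w) \<le> 0" if "w \<in> C" for w
    proof -
      have "\<epsilon> * h (X w) \<le> \<epsilon> * (h (X q) + 1)" using q(2)[OF that] e by (intro mult_left_mono) auto
      also have "\<dots> = - (X p \<bullet> n)" using hq by (simp add: \<epsilon>_def)
      finally show ?thesis using p(2)[OF that] by simp
    qed
    then show ?thesis using e that by blast
  qed
  define \<phi> where "\<phi> x = x \<bullet> n + \<epsilon> * h x" for x
  define Gr where "Gr x = n + \<epsilon> *\<^sub>R (- m + (2 * A * (x \<bullet> m - s0)) *\<^sub>R m - (2 * (x \<bullet> e - t0)) *\<^sub>R e)" for x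
  define H where "H y = \<epsilon> *\<^sub>R ((2 * A * (y \<bullet> m)) *\<^sub>R m - (2 * (y \<bullet> e)) *\<^sub>R e)" for y
  have \<phi>': "(\<phi> has_derivative (\<lambda>h. Gr x \<bullet> h)) (at x)" for x
    unfolding \<phi>_def[abs_def] h_def Gr_def
    by (auto intro!: derivative_eq_intros simp: fun_eq_iff inner_add_left inner_diff_left algebra_simps inner_commute)
  have Gr': "(Gr has_derivative H) (at x)" for x
    unfolding Gr_def[abs_def] H_def
    by (auto intro!: derivative_eq_intros simp: fun_eq_iff algebra_simps)
  obtain p where p: "p \<in> ball w0 \<rho> \<inter> half_plane" and pmax: "\<And>w. w \<in> K \<Longrightarrow> \<phi> (X w) \<le> \<phi> (X p)"
  proof -
    have "continuous_on K (\<lambda>w. \<phi> (X w))" unfolding \<phi>_def using contK by (auto intro!: continuous_intros)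
    then obtain p where p: "p \<in> K" "\<And>w. w \<in> K \<Longrightarrow> \<phi> (X w) \<le> \<phi> (X p)"
      using continuous_attains_sup[OF K(1)] K(3) by blast
    show ?thesis
    proof (cases "dist w0 p = \<rho>")
      case False
      then have "p \<in> ball w0 \<rho> \<inter> half_plane" using p(1) by (simp add: K_def)
      then show ?thesis using p(2) by (rule that)
    next
      case True
      have "\<phi> (X p) \<le> 0"
      proof (cases "p \<in> C")
        case True
        then show ?thesis using \<epsilon>C by (simp add: \<phi>_def)
      next
        case False
        then have "h (X p) < 0" using p(1) True by (auto simp: C_def)
        then have "\<epsilon> * h (X p) < 0" using \<epsilon> by (simp add: mult_pos_neg)
        moreover have "X p \<bullet> n \<le> 0"
        proof (rule near(5))
          show "dist p w0 < r" using True \<rho> by (simp add: dist_commute)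
          show "p \<in> half_plane" using p(1) by (simp add: K_def)
        qed
        ultimately show ?thesis unfolding \<phi>_def by linarith
      qed
      \<comment> \<open>A maximum attained on the rim has value at most 0, so the centre
        \<open>w0\<close> is then a maximum point too and can replace it.\<close>
      moreover have "\<phi> (X w0) = 0" by (simp add: \<phi>_def h_def s0_def t0_def touch)
      ultimately have "\<phi> (X p) \<le> \<phi> (X w0)" by simp
      then have "\<And>w. w \<in> K \<Longrightarrow> \<phi> (X w) \<le> \<phi> (X w0)" using p(2) order_trans by blast
      moreover have "w0 \<in> ball w0 \<rho> \<inter> half_plane" using \<rho> w0 by simp
      ultimately show ?thesis by (rule that[rotated])
    qed
  qed
  have pr: "dist p w0 < r" using p \<rho> by (auto simp: dist_commute)
  have pW: "p \<in> W" "p \<in> W \<inter> half_plane" using p near(1)[OF pr] by auto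
  have ball: "\<forall>\<^sub>F y in nhds p. y \<in> ball w0 \<rho>" using p by (intro eventually_nhds_in_open) auto
  show False
  proof (cases "p $ 1 = 0")
    case False
    then have "p \<in> {y. y $ 1 > 0}" using p by (auto simp: half_plane_def)
    moreover have "open {y::real^2. y $ 1 > 0}" by (intro open_Collect_less continuous_intros)
    ultimately have "\<forall>\<^sub>F y in nhds p. y $ 1 > 0" using eventually_nhds_in_open by fastforce
    then have "\<forall>\<^sub>F y in nhds p. \<phi> (X y) \<le> \<phi> (X p)"
      using ball by eventually_elim (auto simp: half_plane_def K_def intro!: pmax)
    from minimal_surface_trace_hessian_nonpos[OF min lp pW(2) \<phi>' Gr' this]
    have "(\<Sum>i\<in>UNIV. H (X2 p $ i *\<^sub>R X1 p - X1 p $ i *\<^sub>R X2 p) \<bullet> (X2 p $ i *\<^sub>R X1 p - X1 p $ i *\<^sub>R X2 p)) \<le> 0"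
      by (simp add: X1_def X2_def)
    moreover have "(\<Sum>i\<in>UNIV. H (X2 p $ i *\<^sub>R X1 p - X1 p $ i *\<^sub>R X2 p) \<bullet> (X2 p $ i *\<^sub>R X1 p - X1 p $ i *\<^sub>R X2 p))
        = 2 * \<epsilon> * (A * G m p - G e p)"
    proof -
      \<comment> \<open>Pairing the \<open>i\<close>-th tangent vector with \<open>c\<close> gives
        the \<open>i\<close>-th coordinate of the vector whose squared norm defines
        \<open>G\<close>. The Hessian trace is thereby a positive multiple of
        \<open>A * G m p - G e p\<close>, against the maximum.\<close>
      have Gsum: "(\<Sum>i\<in>UNIV. ((X2 p $ i *\<^sub>R X1 p - X1 p $ i *\<^sub>R X2 p) \<bullet> c)\<^sup>2) = G c p" for c
      proof -
        define Y where "Y = (X1 p \<bullet> c) *\<^sub>R X2 p - (X2 p \<bullet> c) *\<^sub>R X1 p"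
        have "G c p = (norm Y)\<^sup>2" by (simp only: G_def Y_def)
        then have "G c p = (\<Sum>i\<in>UNIV. (Y $ i)\<^sup>2)"
          unfolding power2_norm_eq_inner inner_vec_def by (simp add: power2_eq_square)
        moreover have "(X2 p $ i *\<^sub>R X1 p - X1 p $ i *\<^sub>R X2 p) \<bullet> c = Y $ i" for i
          by (simp add: Y_def inner_diff_left mult.commute)
        ultimately show ?thesis by simp
      qed
      have "H v \<bullet> v = 2 * \<epsilon> * (A * (v \<bullet> m)\<^sup>2 - (v \<bullet> e)\<^sup>2)" for v
        by (simp add: H_def inner_diff_left power2_eq_square algebra_simps inner_commute)
      then show ?thesis
        by (simp add: sum_subtractf Gsum flip: sum_distrib_left)
    qed
    ultimately show False using near(2)[OF pr] \<epsilon> by (simp add: mult_le_0_iff)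
  next
    case True
    have D: "((\<lambda>y. \<phi> (X y)) has_derivative (\<lambda>h. Gr (X p) \<bullet> frechet_derivative X (at p) h)) (at p)"
      using has_derivative_compose[OF X'[OF pW(1)] \<phi>'] .
    have "\<forall>\<^sub>F y in nhds p. y \<in> half_plane \<longrightarrow> \<phi> (X y) \<le> \<phi> (X p)"
      using ball by eventually_elim (auto simp: K_def intro!: pmax)
    from half_plane_max[OF D True this]
    have d: "Gr (X p) \<bullet> X2 p = 0" "Gr (X p) \<bullet> X1 p \<le> 0" by (auto simp: X1_def X2_def partial_deriv_def)
    obtain \<alpha> \<beta> where \<alpha>: "\<alpha> < 0" "X p = \<alpha> *\<^sub>R X1 p + \<beta> *\<^sub>R X2 p"
      using free_boundary_outward_position[OF M lp pW(1) True] by (auto simp: X1_def X2_def)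
    \<comment> \<open>At a boundary maximum the outward derivative of \<open>\<phi>\<close> is
      nonnegative. But \<open>x \<bullet> n\<close> is linear, so its radial derivative is its own
      value, at most 0, and \<open>k\<close> adds a negative term.\<close>
    have "Gr (X p) \<bullet> X p = \<alpha> * (Gr (X p) \<bullet> X1 p)" by (subst (2) \<alpha>(2)) (simp add: inner_add_right d)
    then have "Gr (X p) \<bullet> X p \<ge> 0" using \<alpha>(1) d(2) by (simp add: mult_nonpos_nonpos)
    moreover have "Gr (X p) \<bullet> X p = X p \<bullet> n + \<epsilon> * k (X p)"
      by (simp add: Gr_def k_def inner_add_left inner_diff_left inner_commute algebra_simps)
    moreover have "X p \<bullet> n \<le> 0" using near(5)[OF pr] p by auto
    moreover have "\<epsilon> * k (X p) < 0" using near(4)[OF pr] \<epsilon> by (simp add: mult_pos_neg)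
    ultimately show False by linarith
  qed
qed


section \<open>The angle about the line and the conclusion\<close>

text \<open>The coordinates \<open>x \<bullet> a\<close> and \<open>x \<bullet> b\<close> form a
  complex number that is nonzero off the line. A contraction of \<open>M\<close> in the complement
  of the line thus makes this map null-homotopic into the punctured plane, so it has a continuous
  logarithm; \<open>\<theta>\<close> and \<open>R\<close> are its imaginary part and the exponential
  of its real part.\<close>

lemma not_links_imp_continuous_angle:
  assumes "M \<inter> \<Gamma> = {}" "\<not> links M \<Gamma>"
    and axis: "\<And>x. x \<bullet> a = 0 \<Longrightarrow> x \<bullet> b = 0 \<Longrightarrow> x \<in> \<Gamma>"
  obtains \<theta> R where "continuous_on M \<theta>" "\<And>x. x \<in> M \<Longrightarrow> R x > (0::real)"
    "\<And>x. x \<in> M \<Longrightarrow> x \<bullet> a = R x * cos (\<theta> x)" "\<And>x. x \<in> M \<Longrightarrow> x \<bullet> b = R x * sin (\<theta> x)"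
proof -
  obtain c where "homotopic_with_canon (\<lambda>f. f ` surface_boundary M \<subseteq> sphere 0 1 - \<Gamma>)
               M (cball 0 1 - \<Gamma>) id (\<lambda>_. c)"
    using assms unfolding links_def by blast
  then have "homotopic_with_canon (\<lambda>_. True) M (cball 0 1 - \<Gamma>) id (\<lambda>_. c)"
    by (rule homotopic_with_mono) simp
  moreover define f where "f x = Complex (x \<bullet> a) (x \<bullet> b)" for x
  have "continuous_on (cball 0 1 - \<Gamma>) f"
    unfolding f_def Complex_eq by (intro continuous_intros)
  moreover have "f \<in> (cball 0 1 - \<Gamma>) \<rightarrow> - {0}"
    using axis by (auto simp: f_def complex_eq_iff)
  ultimately have "homotopic_with_canon (\<lambda>_. True) M (- {0}) (f \<circ> id) (f \<circ> (\<lambda>_. c))"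
    by (rule homotopic_with_compose_continuous_left)
  then have "\<exists>d. homotopic_with_canon (\<lambda>_. True) M (- {0}) f (\<lambda>_. d)"
    by (auto simp: o_def)
  then obtain g where g: "continuous_on M g" "\<And>x. x \<in> M \<Longrightarrow> f x = exp (g x)"
    using inessential_eq_continuous_logarithm by metis
  show ?thesis
  proof
    show "continuous_on M (\<lambda>x. Im (g x))" using g(1) by (intro continuous_intros)
    show "exp (Re (g x)) > 0" for x by simp
    fix x assume "x \<in> M"
    then have "Complex (x \<bullet> a) (x \<bullet> b) = exp (g x)" using g(2) by (simp add: f_def)
    then show "x \<bullet> a = exp (Re (g x)) * cos (Im (g x))" "x \<bullet> b = exp (Re (g x)) * sin (Im (g x))"
      by (simp_all add: complex_eq_iff Re_exp Im_exp)
  qed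
qed

theorem mainTheorem4:
  fixes M \<Gamma> :: "(real^3) set"
  assumes "embedded_compact_free_boundary_minimal_surface M"
    and "line_through_origin \<Gamma>"
  shows "M \<inter> \<Gamma> \<noteq> {} \<or> links M \<Gamma>"
proof (rule ccontr)
  assume "\<not> (M \<inter> \<Gamma> \<noteq> {} \<or> links M \<Gamma>)"
  then have disj: "M \<inter> \<Gamma> = {}" and nl: "\<not> links M \<Gamma>" by auto
  have sub: "subspace \<Gamma>"
    using assms(2) by (simp add: line_through_origin_def subspace_affine)
  have "dim \<Gamma> = 1" using assms(2) sub by (simp add: line_through_origin_def aff_dim_subspace)
  then have "\<not> \<Gamma> \<subseteq> {0}" using dim_eq_0[of \<Gamma>] by simp
  then obtain e where e: "e \<in> \<Gamma>" "e \<noteq> 0" by blast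
  obtain a where a: "a \<noteq> 0" "e \<bullet> a = 0"
    using orthogonal_to_vector_exists[of e] by (auto simp: orthogonal_def)
  \<comment> \<open>\<open>a\<close> and \<open>b\<close> are orthogonal directions normal to the
    line, not necessarily of equal length; with \<open>e\<close> they separate points.\<close>
  define b where "b = cross3 e a"
  have b: "b \<noteq> 0"
    using norm_and_cross_eq_0[of e a] a e by (auto simp: b_def)
  have basis: "x = 0" if "x \<bullet> a = 0" "x \<bullet> b = 0" "x \<bullet> e = 0" for x
    using inner_orthogonal_span_cross[of e a x x] that b by (simp add: b_def)
  have axis: "x \<in> \<Gamma>" if "x \<bullet> a = 0" "x \<bullet> b = 0" for x
  proof -
    have "x - ((x \<bullet> e) / (e \<bullet> e)) *\<^sub>R e = 0"
      using that a e by (intro basis) (auto simp: inner_diff_left b_def dot_cross_self)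
    then show ?thesis using sub e(1) by (metis eq_iff_diff_eq_0 subspace_scale)
  qed
  obtain \<theta> R where \<theta>: "continuous_on M \<theta>" and R: "\<And>x. x \<in> M \<Longrightarrow> R x > (0::real)"
    and xa: "\<And>x. x \<in> M \<Longrightarrow> x \<bullet> a = R x * cos (\<theta> x)"
    and xb: "\<And>x. x \<in> M \<Longrightarrow> x \<bullet> b = R x * sin (\<theta> x)"
    using not_links_imp_continuous_angle[OF disj nl axis] by blast
  have M: "compact M" "M \<noteq> {}" and charts: "\<And>p. p \<in> M \<Longrightarrow> \<exists>X W. local_param M X W \<and> p \<in> X ` (W \<inter> half_plane)"
    using assms(1) by (auto simp: embedded_compact_free_boundary_minimal_surface_def minimal_surface_def embedded_surface_def)
  obtain p where p: "p \<in> M" "\<And>x. x \<in> M \<Longrightarrow> \<theta> x \<le> \<theta> p"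
    using continuous_attains_sup[OF M \<theta>] by blast
  \<comment> \<open>These rotate the coordinate pair \<open>x \<bullet> a\<close>,
    \<open>x \<bullet> b\<close> by the maximal angle, so that points of \<open>M\<close> at that
    angle satisfy \<open>x \<bullet> n = 0\<close> and \<open>x \<bullet> m > 0\<close>.\<close>
  define m n where "m = cos (\<theta> p) *\<^sub>R a + sin (\<theta> p) *\<^sub>R b" and "n = cos (\<theta> p) *\<^sub>R b - sin (\<theta> p) *\<^sub>R a"
  have xm: "x \<bullet> m = R x * cos (\<theta> x - \<theta> p)" and xn: "x \<bullet> n = R x * sin (\<theta> x - \<theta> p)" if "x \<in> M" for x
    using xa[OF that] xb[OF that]
    by (simp_all add: m_def n_def inner_add_right inner_diff_right cos_diff sin_diff algebra_simps)
  have basis': "x = 0" if "x \<bullet> m = 0" "x \<bullet> n = 0" "x \<bullet> e = 0" for x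
  proof (rule basis[OF _ _ that(3)])
    have "cos (\<theta> p) * (x \<bullet> a) + sin (\<theta> p) * (x \<bullet> b) = 0" "cos (\<theta> p) * (x \<bullet> b) = sin (\<theta> p) * (x \<bullet> a)"
      using that by (simp_all add: m_def n_def inner_add_right inner_diff_right)
    then show "x \<bullet> a = 0" "x \<bullet> b = 0" using sin_cos_squared_add[of "\<theta> p"] by algebra+
  qed
  \<comment> \<open>\<open>Z\<close> is the set of all maximum points of the angle; minimizing
    \<open>x \<bullet> m\<close> over it selects the touching point nearest to the line.\<close>
  define Z where "Z = M \<inter> \<theta> -` {\<theta> p}"
  have "compact Z" using continuous_closed_preimage[OF \<theta> compact_imp_closed[OF M(1)], of "{\<theta> p}"]
      compact_Int_closed[OF M(1), of Z] by (simp add: Z_def Int_absorb1)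
  moreover have "Z \<noteq> {}" using p(1) by (auto simp: Z_def)
  moreover have "continuous_on Z (\<lambda>x. x \<bullet> m)" by (intro continuous_intros)
  ultimately have "\<exists>x\<in>Z. \<forall>y\<in>Z. x \<bullet> m \<le> y \<bullet> m" by (rule continuous_attains_inf)
  then obtain q where q: "q \<in> Z" "\<And>x. x \<in> Z \<Longrightarrow> q \<bullet> m \<le> x \<bullet> m"
    by blast
  have qM: "q \<in> M" "\<theta> q = \<theta> p" using q(1) by (auto simp: Z_def)
  obtain X W w0 where lp: "local_param M X W" and w0: "w0 \<in> W \<inter> half_plane" and qX: "q = X w0"
    using charts[OF qM(1)] by blast
  have XM: "X ` (W \<inter> half_plane) \<subseteq> M" using lp openin_imp_subset unfolding local_param_def by blast
  have "continuous_on (W \<inter> half_plane) (\<lambda>w. \<theta> (X w))"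
    using continuous_on_compose2[OF \<theta> _ XM] lp unfolding local_param_def homeomorphism_def by blast
  \<comment> \<open>Within \<open>pi\<close> of the maximum, the sine of the angle difference
    vanishes only when the difference does. Hence nearby points with
    \<open>x \<bullet> n = 0\<close> belong to \<open>Z\<close>, and all others have
    \<open>x \<bullet> n < 0\<close>.\<close>
  then obtain d where d: "d > 0" "\<And>y. y \<in> W \<inter> half_plane \<Longrightarrow> dist y w0 < d \<Longrightarrow> dist (\<theta> (X y)) (\<theta> (X w0)) < pi"
    using w0 pi_gt_zero unfolding continuous_on_iff by metis
  have "\<forall>\<^sub>F y in nhds w0. y \<in> W \<inter> ball w0 d"
    using w0 d(1) local_param_open[OF lp] by (intro eventually_nhds_in_open) auto
  then have "\<forall>\<^sub>F y in nhds w0. y \<in> half_plane \<longrightarrow> X y \<bullet> n \<le> 0 \<and> (X y \<bullet> n = 0 \<longrightarrow> X w0 \<bullet> m \<le> X y \<bullet> m)"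
  proof (rule eventually_mono, intro impI)
    fix y assume y: "y \<in> W \<inter> ball w0 d" "y \<in> half_plane"
    then have XyM: "X y \<in> M" using XM by blast
    have "dist (\<theta> (X y)) (\<theta> (X w0)) < pi" using d(2)[of y] y by (auto simp: dist_commute)
    then have range: "\<bar>\<theta> (X y) - \<theta> p\<bar> < pi" using qM(2) by (simp add: dist_real_def qX)
    have le: "\<theta> (X y) \<le> \<theta> p" using p(2)[OF XyM] .
    show "X y \<bullet> n \<le> 0 \<and> (X y \<bullet> n = 0 \<longrightarrow> X w0 \<bullet> m \<le> X y \<bullet> m)"
    proof (cases "\<theta> (X y) = \<theta> p")
      case True
      then show ?thesis using q(2)[of "X y"] XyM xn[OF XyM] by (auto simp: Z_def qX)
    next
      case False
      then have "sin (\<theta> p - \<theta> (X y)) > 0" using le range by (intro sin_gt_zero) auto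
      then have "sin (\<theta> (X y) - \<theta> p) < 0" by (metis minus_diff_eq neg_0_less_iff_less sin_minus)
      then have "X y \<bullet> n < 0" unfolding xn[OF XyM] using R[OF XyM] by (simp add: mult_pos_neg)
      then show ?thesis by simp
    qed
  qed
  moreover have "X w0 \<bullet> n = 0" "X w0 \<bullet> m > 0"
    using xn[OF qM(1)] xm[OF qM(1)] R[OF qM(1)] qM(2) by (simp_all add: qX)
  ultimately show False
    using no_one_sided_touching_at_nearest_point[OF assms(1) lp w0 basis'] by blast
qed

end
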